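(* Let $G$ be a connected graph with vertex set $\{1,\dots,n\}$, $n\ge 2$, let $\Phi=(F_1,\dots,F_n)$ be an $n$-tuple of pairwise disjoint graphs with $\delta(F_i)=0$ and $|V(F_i)|\ge 2$ for all $i$, and let $G[\Phi]$ be the generalized lexicographic product. Then $G[\Phi]$ is well $\gamma_t$-dominated if and only if $G$ is well $\gamma_t$-dominated.
   Context: All graphs are finite, simple and undirected; $\delta(H)$ is the minimum degree. The generalized lexicographic product $G[\Phi]$ is the graph with vertex set $\bigcup_{i=1}^n V(F_i)$ in which each $F_i$ is an induced subgraph, and for $x\in V(F_i)$, $y\in V(F_j)$ with $i\neq j$, $xy$ is an edge iff $ij\in E(G)$. A total dominating set of $H$ is a set $S$ such that every vertex of $H$ has a neighbor in $S$; it is minimal if no proper subset is total dominating. $\gamma_t(H)$ is the minimum and $\Gamma_t(H)$ the maximum cardinality of a minimal total dominating set; $H$ is well $\gamma_t$-dominated if $\gamma_t(H)=\Gamma_t(H)$. *)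

theory Defs
  imports "Graph_Theory.Digraph_Component" "HOL-Library.Disjoint_Sets"
begin

text \<open>
  A finite simple undirected graph is a \<^locale>\<open>pair_graph\<close>: finitely many vertices and a
  symmetric, loop-free set of ordered pairs, the edge \<open>uv\<close> being the two pairs
  \<open>(u, v)\<close> and \<open>(v, u)\<close>. Hence the degree of a vertex is its out-degree.
\<close>

definition min_degree :: "'a pair_pre_digraph \<Rightarrow> nat" where
  "min_degree H = Min (out_degree (with_proj H) ` pverts H)"

text \<open>The vertices of \<open>G\<close> index the family \<open>\<Phi>\<close>; values of \<open>\<Phi>\<close> elsewhere are irrelevant.\<close>

definition gen_lex_prod ::
    "'i pair_pre_digraph \<Rightarrow> ('i \<Rightarrow> 'a pair_pre_digraph) \<Rightarrow> 'a pair_pre_digraph" where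
  "gen_lex_prod G \<Phi> =
    \<lparr> pverts = (\<Union>i\<in>pverts G. pverts (\<Phi> i)),
      parcs = (\<Union>i\<in>pverts G. parcs (\<Phi> i)) \<union>
        {(x, y). \<exists>i\<in>pverts G. \<exists>j\<in>pverts G. i \<noteq> j \<and> x \<in> pverts (\<Phi> i) \<and> y \<in> pverts (\<Phi> j)
          \<and> (i, j) \<in> parcs G} \<rparr>"

definition total_dominating :: "'a pair_pre_digraph \<Rightarrow> 'a set \<Rightarrow> bool" where
  "total_dominating H S \<longleftrightarrow> S \<subseteq> pverts H \<and> (\<forall>v\<in>pverts H. \<exists>u\<in>S. (v, u) \<in> parcs H)"

definition minimal_total_dominating :: "'a pair_pre_digraph \<Rightarrow> 'a set \<Rightarrow> bool" where
  "minimal_total_dominating H S \<longleftrightarrow>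
    total_dominating H S \<and> (\<forall>T. T \<subset> S \<longrightarrow> \<not> total_dominating H T)"

text \<open>
  Both parameters are meaningful only if \<open>H\<close> has a total dominating set, that is, no isolated
  vertex; otherwise \<^const>\<open>Min\<close> and \<^const>\<open>Max\<close> are applied to the empty set.
\<close>

definition lower_total_dom :: "'a pair_pre_digraph \<Rightarrow> nat" (\<open>\<gamma>\<^sub>t\<close>) where
  "\<gamma>\<^sub>t H = Min (card ` {S. minimal_total_dominating H S})"

definition upper_total_dom :: "'a pair_pre_digraph \<Rightarrow> nat" (\<open>\<Gamma>\<^sub>t\<close>) where
  "\<Gamma>\<^sub>t H = Max (card ` {S. minimal_total_dominating H S})"

definition well_total_dominated :: "'a pair_pre_digraph \<Rightarrow> bool" where
  "well_total_dominated H \<longleftrightarrow> \<gamma>\<^sub>t H = \<Gamma>\<^sub>t H"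


lemma pair_graph_gen_lex_prod:
  assumes "pair_graph G" and "\<And>i. i \<in> pverts G \<Longrightarrow> pair_graph (\<Phi> i)"
    and disj: "disjoint_family_on (\<lambda>i. pverts (\<Phi> i)) (pverts G)"
  shows "pair_graph (gen_lex_prod G \<Phi>)"
proof -
  interpret G: pair_graph G by fact
  let ?H = "gen_lex_prod G \<Phi>"
  have wf: "u \<in> pverts (\<Phi> i) \<and> v \<in> pverts (\<Phi> i) \<and> u \<noteq> v \<and> (v, u) \<in> parcs (\<Phi> i)"
    if "i \<in> pverts G" "(u, v) \<in> parcs (\<Phi> i)" for i u v
  proof -
    interpret F: pair_graph "\<Phi> i" using assms that by blast
    show ?thesis
      using F.wellformed' F.no_loops' F.pair_sym_arcs that(2)
      by (auto simp: symmetric_def dest: symD)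
  qed
  have sym: "(j, i) \<in> parcs G" if "(i, j) \<in> parcs G" for i j
    using G.pair_sym_arcs that by (auto simp: symmetric_def dest: symD)
  have fin: "finite (pverts ?H)"
    using G.pair_finite_verts assms(2)
    by (auto simp: gen_lex_prod_def pair_graph_def pair_digraph_def pair_fin_digraph_def
        pair_fin_digraph_axioms_def)
  have arcs: "u \<in> pverts ?H \<and> v \<in> pverts ?H \<and> u \<noteq> v \<and> (v, u) \<in> parcs ?H"
    if "(u, v) \<in> parcs ?H" for u v
  proof -
    from that consider
        (inner) i where "i \<in> pverts G" "(u, v) \<in> parcs (\<Phi> i)"
      | (outer) i j where "i \<in> pverts G" "j \<in> pverts G" "i \<noteq> j" "u \<in> pverts (\<Phi> i)"
          "v \<in> pverts (\<Phi> j)" "(i, j) \<in> parcs G"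
      by (auto simp: gen_lex_prod_def)
    then show ?thesis
    proof cases
      case inner
      then show ?thesis using wf[OF inner] by (auto simp: gen_lex_prod_def)
    next
      case outer
      then have "u \<noteq> v" using disj by (auto simp: disjoint_family_on_def)
      moreover have "(v, u) \<in> parcs ?H"
        using outer(1-5) sym[OF outer(6)] by (fastforce simp: gen_lex_prod_def)
      ultimately show ?thesis using outer(1,2,4,5) by (auto simp: gen_lex_prod_def)
    qed
  qed
  have "finite (parcs ?H)"
    by (rule finite_subset[of _ "pverts ?H \<times> pverts ?H"]) (use fin arcs in auto)
  then show ?thesis
    using fin arcs by unfold_locales (auto simp: symmetric_def intro!: symI)
qed

lemma induced_subgraph_gen_lex_prod:
  assumes "pair_graph G" and "\<And>i. i \<in> pverts G \<Longrightarrow> pair_graph (\<Phi> i)"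
    and disj: "disjoint_family_on (\<lambda>i. pverts (\<Phi> i)) (pverts G)"
    and i: "i \<in> pverts G"
  shows "induced_subgraph (with_proj (\<Phi> i)) (with_proj (gen_lex_prod G \<Phi>))"
proof -
  let ?H = "gen_lex_prod G \<Phi>"
  interpret H: pair_graph ?H using assms by (intro pair_graph_gen_lex_prod)
  interpret F: pair_graph "\<Phi> i" using assms by blast
  have wf: "u \<in> pverts (\<Phi> j) \<and> v \<in> pverts (\<Phi> j)"
    if "j \<in> pverts G" "(u, v) \<in> parcs (\<Phi> j)" for j u v
  proof -
    interpret Fj: pair_graph "\<Phi> j" using assms that by blast
    show ?thesis using Fj.wellformed' that(2) by blast
  qed
  have eq: "j = k" if "x \<in> pverts (\<Phi> j)" "x \<in> pverts (\<Phi> k)" "j \<in> pverts G" "k \<in> pverts G" for j k x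
    using disj that unfolding disjoint_family_on_def by blast
  have "(u, v) \<in> parcs (\<Phi> i) \<longleftrightarrow>
      (u, v) \<in> parcs ?H \<and> u \<in> pverts (\<Phi> i) \<and> v \<in> pverts (\<Phi> i)" for u v
  proof (intro iffI conjI; (elim conjE)?)
    assume uv: "(u, v) \<in> parcs (\<Phi> i)"
    show "(u, v) \<in> parcs ?H" using uv i by (auto simp: gen_lex_prod_def)
    show "u \<in> pverts (\<Phi> i)" "v \<in> pverts (\<Phi> i)" using wf[OF i uv] by auto
  next
    assume uv: "(u, v) \<in> parcs ?H" "u \<in> pverts (\<Phi> i)" "v \<in> pverts (\<Phi> i)"
    from uv(1) consider
        (inner) j where "j \<in> pverts G" "(u, v) \<in> parcs (\<Phi> j)"
      | (outer) j k where "j \<in> pverts G" "k \<in> pverts G" "j \<noteq> k" "u \<in> pverts (\<Phi> j)"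
          "v \<in> pverts (\<Phi> k)"
      by (auto simp: gen_lex_prod_def)
    then show "(u, v) \<in> parcs (\<Phi> i)"
    proof cases
      case inner
      then have "j = i" using eq[of u j i] wf[OF inner] uv i by blast
      then show ?thesis using inner by simp
    next
      case outer
      then show ?thesis using eq[of u j i] eq[of v k i] uv i by blast
    qed
  qed
  moreover have "pverts (\<Phi> i) \<subseteq> pverts ?H"
    using i by (auto simp: gen_lex_prod_def)
  ultimately show ?thesis
    using H.wf_digraph F.wf_digraph
    by (auto simp: induced_subgraph_def subgraph_def compatible_def)
qed

lemma ex_minimal_total_dominating:
  assumes "pair_graph H" and "\<And>v. v \<in> pverts H \<Longrightarrow> \<exists>u. (v, u) \<in> parcs H"
  shows "\<exists>S. minimal_total_dominating H S"
proof -
  interpret H: pair_graph H by fact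
  let ?A = "{S. total_dominating H S}"
  have "finite ?A"
    by (rule finite_subset[of _ "Pow (pverts H)"])
      (auto simp: total_dominating_def H.pair_finite_verts)
  moreover have "pverts H \<in> ?A"
    using assms(2) H.wellformed' by (fastforce simp: total_dominating_def)
  ultimately obtain S where "S \<in> ?A" "\<forall>T\<in>?A. T \<subseteq> S \<longrightarrow> S = T"
    using finite_has_minimal[of ?A] by blast
  then show ?thesis by (auto simp: minimal_total_dominating_def)
qed

end

theory Submission
  imports Defs
begin

text \<open>
  Since every fibre \<open>F\<^sub>i\<close> contains an isolated vertex, whose neighbours in \<open>G[\<Phi>]\<close> all lie in the
  fibres over the neighbours of \<open>i\<close>, a set \<open>S\<close> is total dominating in \<open>G[\<Phi>]\<close> if and only if its
  projection to \<open>G\<close> is. Hence a minimal total dominating set of \<open>G[\<Phi>]\<close> meets each fibre at most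
  once and projects bijectively onto a minimal total dominating set of \<open>G\<close>; conversely, every
  choice of representatives of a minimal total dominating set of \<open>G\<close> is minimal in \<open>G[\<Phi>]\<close>. So both
  graphs have minimal total dominating sets of exactly the same cardinalities.
\<close>

text \<open>The minimum is attained because the set of degrees is finite and nonempty.\<close>

lemma ex_isolated_vertex_if_min_degree_0:
  assumes "pair_graph F" and "pverts F \<noteq> {}" and "min_degree F = 0"
  obtains z where "z \<in> pverts F" and "\<And>u. (z, u) \<notin> parcs F"
proof -
  interpret F: pair_graph F by fact
  have "min_degree F \<in> out_degree (with_proj F) ` pverts F"
    unfolding min_degree_def using assms(2) by (intro Min_in) auto
  then obtain z where z: "z \<in> pverts F" "out_degree (with_proj F) z = 0"
    using assms(3) by auto
  have "out_arcs (with_proj F) z = {}"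
    using z(2) F.finite_out_arcs by (simp add: out_degree_def)
  then have "(z, u) \<notin> parcs F" for u
    by (auto simp: out_arcs_def)
  with z(1) show thesis by (rule that)
qed

text \<open>Isolates the counting: adjacency enters only through \<open>td\<close>, so the argument
  concerns minimal sets of a family pulled back along a surjection \<open>p\<close>.\<close>

lemma card_minimal_total_dominating_eq_if_projection:
  assumes surj: "p ` pverts H = pverts G"
    and td: "\<And>S. S \<subseteq> pverts H \<Longrightarrow> total_dominating H S \<longleftrightarrow> total_dominating G (p ` S)"
  shows "card ` {S. minimal_total_dominating H S} = card ` {D. minimal_total_dominating G D}"
proof (intro equalityI subsetI)
  fix k assume "k \<in> card ` {S. minimal_total_dominating H S}"
  then obtain S where S: "minimal_total_dominating H S" "k = card S" by auto
  then have tdS: "total_dominating H S"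
    and min: "T \<subseteq> S \<Longrightarrow> total_dominating H T \<Longrightarrow> T = S" for T
    by (auto simp: minimal_total_dominating_def)
  have SV: "S \<subseteq> pverts H" using tdS by (simp add: total_dominating_def)
  obtain T where T: "T \<subseteq> S" "inj_on p T" "p ` T = p ` S"
    using subset_image_inj[of "p ` S" p S] by auto
  have "T = S" using min[OF T(1)] td[of S] td[of T] tdS SV T by auto
  with T have inj: "inj_on p S" by simp
  have "\<not> total_dominating G D" if DS: "D \<subset> p ` S" for D
  proof
    assume D: "total_dominating G D"
    obtain T where T: "T \<subseteq> S" "D = p ` T"
      using DS by (meson psubset_imp_subset subset_imageE)
    then have "T = S" using min[OF T(1)] td[of T] D SV by auto
    with DS T show False by simp
  qed
  then have "minimal_total_dominating G (p ` S)"
    using td[OF SV] tdS by (simp add: minimal_total_dominating_def)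
  then show "k \<in> card ` {D. minimal_total_dominating G D}"
    using S(2) card_image[OF inj] by (metis image_eqI mem_Collect_eq)
next
  fix k assume "k \<in> card ` {D. minimal_total_dominating G D}"
  then obtain D where D: "minimal_total_dominating G D" "k = card D" by auto
  then have tdD: "total_dominating G D" by (simp add: minimal_total_dominating_def)
  then have DV: "D \<subseteq> p ` pverts H" using surj by (simp add: total_dominating_def)
  \<comment> \<open>Any choice of one preimage per element of \<open>D\<close>; injectivity makes
    images of proper subsets of \<open>S\<close> proper subsets of \<open>D\<close>.\<close>
  obtain S where S: "S \<subseteq> pverts H" "inj_on p S" "D = p ` S"
    using DV subset_image_inj[of D p "pverts H"] by auto
  have "\<not> total_dominating H T" if "T \<subset> S" for T
  proof -
    have "p ` T \<subset> D" using image_strict_mono[OF S(2) that] S(3) by simp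
    then have "\<not> total_dominating G (p ` T)"
      using D(1) by (simp add: minimal_total_dominating_def)
    then show ?thesis using td[of T] that S(1) by auto
  qed
  then have "minimal_total_dominating H S"
    using td[OF S(1)] tdD S(3) by (simp add: minimal_total_dominating_def)
  then show "k \<in> card ` {S. minimal_total_dominating H S}"
    using D(2) S card_image[OF S(2)] by (metis image_eqI mem_Collect_eq)
qed

text \<open>Left to right, an isolated vertex of each fibre can only be dominated from another
  fibre. Right to left, an arc of \<open>G\<close> joins every vertex of one fibre to every vertex
  of the other.\<close>

lemma total_dominating_gen_lex_prod_iff:
  assumes G: "pair_graph G"
    and \<Phi>: "\<And>i. i \<in> pverts G \<Longrightarrow> pair_graph (\<Phi> i)"
    and ne: "\<And>i. i \<in> pverts G \<Longrightarrow> pverts (\<Phi> i) \<noteq> {}"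
    and deg: "\<And>i. i \<in> pverts G \<Longrightarrow> min_degree (\<Phi> i) = 0"
    and p: "\<And>i x. i \<in> pverts G \<Longrightarrow> x \<in> pverts (\<Phi> i) \<Longrightarrow> p x = i"
    and S: "S \<subseteq> pverts (gen_lex_prod G \<Phi>)"
  shows "total_dominating (gen_lex_prod G \<Phi>) S \<longleftrightarrow> total_dominating G (p ` S)"
proof
  interpret G: pair_graph G by fact
  let ?H = "gen_lex_prod G \<Phi>"
  have pS: "p ` S \<subseteq> pverts G"
    using S p by (fastforce simp: gen_lex_prod_def)
  {
    assume td: "total_dominating ?H S"
    have "\<exists>j\<in>p ` S. (i, j) \<in> parcs G" if i: "i \<in> pverts G" for i
    proof -
      obtain z where z: "z \<in> pverts (\<Phi> i)" "\<And>u. (z, u) \<notin> parcs (\<Phi> i)"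
        using ex_isolated_vertex_if_min_degree_0[OF \<Phi>[OF i] ne[OF i] deg[OF i]] by blast
      have "z \<in> pverts ?H" using i z(1) by (auto simp: gen_lex_prod_def)
      then obtain u where u: "u \<in> S" "(z, u) \<in> parcs ?H"
        using td by (auto simp: total_dominating_def)
      \<comment> \<open>Excludes arcs inside any fibre: such an arc would put \<open>z\<close> into
        fibre \<open>j\<close>, and \<open>p\<close> then gives \<open>j = i\<close>. So the arc
        from \<open>z\<close> to \<open>u\<close> comes from an arc of \<open>G\<close>.\<close>
      have "(z, u) \<notin> parcs (\<Phi> j)" if j: "j \<in> pverts G" for j
      proof
        interpret F: pair_graph "\<Phi> j" using \<Phi>[OF j] .
        assume zu: "(z, u) \<in> parcs (\<Phi> j)"
        then have "z \<in> pverts (\<Phi> j)" using F.wellformed' by blast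
        then have "j = i" using p[OF i z(1)] p[OF j] by simp
        then show False using zu z(2) by simp
      qed
      then obtain j k where "j \<in> pverts G" "k \<in> pverts G" "z \<in> pverts (\<Phi> j)"
          "u \<in> pverts (\<Phi> k)" "(j, k) \<in> parcs G"
        using u(2) by (auto simp: gen_lex_prod_def)
      then have "(p z, p u) \<in> parcs G" using p by simp
      then show ?thesis using p[OF i z(1)] u(1) by auto
    qed
    with pS show "total_dominating G (p ` S)" by (simp add: total_dominating_def)
  next
    assume td: "total_dominating G (p ` S)"
    have "\<exists>u\<in>S. (v, u) \<in> parcs ?H" if v: "v \<in> pverts ?H" for v
    proof -
      obtain i where i: "i \<in> pverts G" "v \<in> pverts (\<Phi> i)"
        using v by (auto simp: gen_lex_prod_def)
      then obtain u where u: "u \<in> S" "(i, p u) \<in> parcs G"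
        using td by (auto simp: total_dominating_def)
      then obtain j where j: "j \<in> pverts G" "u \<in> pverts (\<Phi> j)"
        using S by (auto simp: gen_lex_prod_def)
      have "(i, j) \<in> parcs G" using u(2) p[OF j] by simp
      \<comment> \<open>Arcs between fibres are defined for distinct indices only.\<close>
      moreover from this have "i \<noteq> j" using G.no_loops' by blast
      ultimately have "(v, u) \<in> parcs ?H"
        using i j by (auto simp: gen_lex_prod_def)
      with u(1) show ?thesis by blast
    qed
    with S show "total_dominating ?H S" by (simp add: total_dominating_def)
  }
qed

lemma card_minimal_total_dominating_gen_lex_prod:
  assumes "pair_graph G"
    and "\<And>i. i \<in> pverts G \<Longrightarrow> pair_graph (\<Phi> i)"
    and disj: "disjoint_family_on (\<lambda>i. pverts (\<Phi> i)) (pverts G)"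
    and ne: "\<And>i. i \<in> pverts G \<Longrightarrow> pverts (\<Phi> i) \<noteq> {}"
    and "\<And>i. i \<in> pverts G \<Longrightarrow> min_degree (\<Phi> i) = 0"
  shows "card ` {S. minimal_total_dominating (gen_lex_prod G \<Phi>) S} =
    card ` {D. minimal_total_dominating G D}"
proof -
  \<comment> \<open>Disjointness of the fibres makes this index unique; nonempty fibres make
    \<open>p\<close> surjective onto \<open>pverts G\<close>.\<close>
  define p where "p x = (THE i. i \<in> pverts G \<and> x \<in> pverts (\<Phi> i))" for x
  have p: "p x = i" if "i \<in> pverts G" "x \<in> pverts (\<Phi> i)" for i x
    unfolding p_def using that disj
    by (intro the_equality) (auto simp: disjoint_family_on_def)
  have "p ` pverts (gen_lex_prod G \<Phi>) = pverts G"
  proof (intro equalityI subsetI)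
    fix i assume "i \<in> pverts G"
    moreover from this obtain x where "x \<in> pverts (\<Phi> i)" using ne by blast
    ultimately show "i \<in> p ` pverts (gen_lex_prod G \<Phi>)"
      using p[of i x] by (force simp: gen_lex_prod_def)
  qed (auto simp: gen_lex_prod_def p)
  then show ?thesis
    by (rule card_minimal_total_dominating_eq_if_projection)
      (rule total_dominating_gen_lex_prod_iff[OF assms(1,2) ne assms(5) p])
qed

theorem theorem3p11:
  fixes n :: nat
    and G :: "nat pair_pre_digraph"
    and \<Phi> :: "nat \<Rightarrow> 'a pair_pre_digraph"
  assumes "n \<ge> 2"
    and "pair_graph G"
    and "pverts G = {1..n}"
    and "Digraph_Component.connected (with_proj G)"
    and "\<And>i. i \<in> {1..n} \<Longrightarrow> pair_graph (\<Phi> i)"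
    and "disjoint_family_on (\<lambda>i. pverts (\<Phi> i)) {1..n}"
    and "\<And>i. i \<in> {1..n} \<Longrightarrow> min_degree (\<Phi> i) = 0"
    and "\<And>i. i \<in> {1..n} \<Longrightarrow> card (pverts (\<Phi> i)) \<ge> 2"
  shows "well_total_dominated (gen_lex_prod G \<Phi>) \<longleftrightarrow> well_total_dominated G"
proof -
  have "pverts (\<Phi> i) \<noteq> {}" if "i \<in> pverts G" for i
    using assms(8)[of i] assms(3) that by auto
  then have "card ` {S. minimal_total_dominating (gen_lex_prod G \<Phi>) S} =
      card ` {D. minimal_total_dominating G D}"
    using assms(2,3,5-7) by (intro card_minimal_total_dominating_gen_lex_prod) auto
  \<comment> \<open>Both parameters are the \<open>Min\<close> and \<open>Max\<close> of this common
    set of cardinalities.\<close>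
  then show ?thesis
    by (simp add: well_total_dominated_def lower_total_dom_def upper_total_dom_def)
qed

end
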